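(* Let $V$ be a finite set with $|V|>1$, let $(\mathsf Z_i : i\in V)$ be discrete random variables with entropy function $H$. The modified decomposition algorithm (MDA) outputs the minimum sum-rate $\alpha=R_{\mathrm{ACO}}(V)$, the fundamental partition $\mathcal P^*$ and an optimal rate vector $\mathbf r_V\in\mathscr R^*_{\mathrm{ACO}}(V)$ for the asymptotic model. Moreover, the estimation sequence of $R_{\mathrm{ACO}}(V)$, i.e. the sequence of values of $\alpha$ over the iterations of the algorithm, converges monotonically upward to $R_{\mathrm{ACO}}(V)$.
   Context: For $X\subseteq V$, $H(X)$ is the (finite) Shannon entropy of $(\mathsf Z_i: i\in X)$, $H(\emptyset)=0$, $H(X|Y)=H(X\cup Y)-H(Y)$. For $\mathbf r_V\in\mathbb R^{|V|}$, $r(X)=\sum_{i\in X}r_i$. $\mathscr R_{\mathrm{CO}}(V)=\{\mathbf r_V: r(X)\ge H(X|V\setminus X)\ \forall X\subsetneq V\}$; $R_{\mathrm{ACO}}(V)=\min\{r(V):\mathbf r_V\in\mathscr R_{\mathrm{CO}}(V)\}$; $\mathscr R^*_{\mathrm{ACO}}(V)=\{\mathbf r_V\in\mathscr R_{\mathrm{CO}}(V): r(V)=R_{\mathrm{ACO}}(V)\}$. $\Pi(X)$ is the set of partitions of $X$ into nonempty disjoint subsets; $\Pi'(V)=\{\mathcal P\in\Pi(V):|\mathcal P|>1\}$. For $\mathcal P\in\Pi'(V)$, $\varphi(\mathcal P)=\sum_{C\in\mathcal P}\frac{H(V)-H(C)}{|\mathcal P|-1}$. One has $R_{\mathrm{ACO}}(V)=\max_{\mathcal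 P\in\Pi'(V)}\varphi(\mathcal P)$, and the unique finest maximizer is called the fundamental partition $\mathcal P^*$. For $\alpha\ge 0$: $f^{\#}_\alpha(\emptyset)=0$ and $f^{\#}_\alpha(X)=\alpha-H(V)+H(X)$ for $\emptyset\ne X\subseteq V$; $f^{\#}_\alpha[\mathcal P]=\sum_{C\in\mathcal P}f^{\#}_\alpha(C)$; Dilworth truncation $\hat f^{\#}_\alpha(X)=\min_{\mathcal P\in\Pi(X)}f^{\#}_\alpha[\mathcal P]$, $\hat f^{\#}_\alpha(\emptyset)=0$. For given $\alpha$ the minimizers of $\min_{\mathcal P\in\Pi(V)}f^{\#}_\alpha[\mathcal P]$ have a unique finest (minimal) element. $B(\hat f^{\#}_\alpha,\le)=\{\mathbf r_V\in\mathbb R^{|V|}: r(X)\le\hat f^{\#}_\alpha(X)\ \forall X\subseteq V,\ r(V)=\hat f^{\#}_\alpha(V)\}$. MDA algorithm: (1) set $\alpha\leftarrow\max\big\{\max_{i\in V}\varphi(\{\{i\},V\setminus\{i\}\}),\ \varphi(\{\{m\}:m\in V\})\big\}$; (2) find the finest minimizer $\mathcal P^*$ of $\min_{\mathcal P\in\Pi(V)}f^{\#}_\alpha[\mathcal P]$ and some $\mathbf r_V\in B(\hat f^{\#}_\alpha,\le)$; (3) set $\hat\alpha\leftarrow\varphi(\mathcal P^* )$; (4) while $\hat\alpha\neq\alpha$: set $\alpha\leftarrow\hat\alpha$; find the finest minimizer $\mathcal P^*$ of $\min_{\mathcal P\in\Pi(V)}f^{\#}_\alpha[\mathcal P]$ and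 some $\mathbf r_V\in B(\hat f^{\#}_\alpha,\le)$; set $\hat\alpha\leftarrow\varphi(\mathcal P^* )$; (5) return $\alpha$, $\mathcal P^*$, $\mathbf r_V$. *)

theory Defs
  imports "HOL-Probability.Probability" "HOL-Library.Disjoint_Sets"
begin

(* Shannon entropy (logarithm to base b) of the tuple (Z i : i \<in> X), where Z i takes
   values in the countable alphabet A i.  Every tuple is a discrete random variable, so
   the reference measure is the counting measure on the product alphabet.
   HOL-Probability's entropy is a Bochner integral, hence 0 when the entropy is infinite;
   it is meaningful only together with finite_joint_entropy. *)

definition tuple_rv :: "('i \<Rightarrow> 'w \<Rightarrow> 'a) \<Rightarrow> 'i set \<Rightarrow> 'w \<Rightarrow> 'i \<Rightarrow> 'a" where
  "tuple_rv Z X \<omega> = (\<lambda>i\<in>X. Z i \<omega>)"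

definition tuple_space :: "('i \<Rightarrow> 'a set) \<Rightarrow> 'i set \<Rightarrow> ('i \<Rightarrow> 'a) measure" where
  "tuple_space A X = count_space (\<Pi>\<^sub>E i\<in>X. A i)"

definition finite_joint_entropy ::
  "'w measure \<Rightarrow> real \<Rightarrow> ('i \<Rightarrow> 'a set) \<Rightarrow> ('i \<Rightarrow> 'w \<Rightarrow> 'a) \<Rightarrow> 'i set \<Rightarrow> bool" where
  "finite_joint_entropy M b A Z X \<longleftrightarrow>
     (\<exists>p. information_space.finite_entropy M b (tuple_space A X) (tuple_rv Z X) p)"

definition joint_entropy ::
  "'w measure \<Rightarrow> real \<Rightarrow> ('i \<Rightarrow> 'a set) \<Rightarrow> ('i \<Rightarrow> 'w \<Rightarrow> 'a) \<Rightarrow> 'i set \<Rightarrow> real" where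
  "joint_entropy M b A Z X = prob_space.entropy M b (tuple_space A X) (tuple_rv Z X)"

lemma joint_entropy_empty:
  fixes Z :: "'i \<Rightarrow> 'w \<Rightarrow> 'a"
  assumes "information_space M b"
  shows "joint_entropy M b A Z {} = 0"
proof -
  interpret information_space M b by fact
  let ?S = "count_space {\<lambda>_. undefined} :: ('i \<Rightarrow> 'a) measure"
  have rv: "tuple_rv Z {} = (\<lambda>\<omega> _. undefined)"
    by (simp add: fun_eq_iff tuple_rv_def)
  have "distr M ?S (tuple_rv Z {}) = ?S"
  proof (rule measure_eqI)
    fix B assume "B \<in> sets (distr M ?S (tuple_rv Z {}))"
    then have "B = {} \<or> B = {\<lambda>_. undefined}" by auto
    then show "emeasure (distr M ?S (tuple_rv Z {})) B = emeasure ?S B"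
      unfolding rv by (auto simp: emeasure_distr emeasure_space_1)
  qed simp
  moreover have "sigma_finite_measure ?S"
    by (rule sigma_finite_measure_count_space_finite) simp
  ultimately show ?thesis
    using sigma_finite_measure.KL_same_eq_0[of ?S b]
    by (simp add: joint_entropy_def entropy_def tuple_space_def PiE_empty_domain)
qed


(* From here on H is an arbitrary set function on the subsets of V. *)

definition cond_entropy :: "('i set \<Rightarrow> real) \<Rightarrow> 'i set \<Rightarrow> 'i set \<Rightarrow> real" where
  "cond_entropy H X Y = H (X \<union> Y) - H Y"

(* Rate vectors indexed by V are the elements of extensional V. *)
definition R_CO :: "('i set \<Rightarrow> real) \<Rightarrow> 'i set \<Rightarrow> ('i \<Rightarrow> real) set" where
  "R_CO H V = {r \<in> extensional V. \<forall>X. X \<subset> V \<longrightarrow> sum r X \<ge> cond_entropy H X (V - X)}"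

(* The infimum is attained exactly when opt_rates is nonempty. *)
definition R_ACO :: "('i set \<Rightarrow> real) \<Rightarrow> 'i set \<Rightarrow> real" where
  "R_ACO H V = (INF r\<in>R_CO H V. sum r V)"

definition opt_rates :: "('i set \<Rightarrow> real) \<Rightarrow> 'i set \<Rightarrow> ('i \<Rightarrow> real) set" where
  "opt_rates H V = {r \<in> R_CO H V. sum r V = R_ACO H V}"

definition parts :: "'i set \<Rightarrow> 'i set set set" where
  "parts X = {P. partition_on X P}"

definition proper_parts :: "'i set \<Rightarrow> 'i set set set" where
  "proper_parts X = {P \<in> parts X. card P > 1}"

definition finest_in :: "'i set \<Rightarrow> 'i set set set \<Rightarrow> 'i set set \<Rightarrow> bool" where
  "finest_in V S P \<longleftrightarrow> P \<in> S \<and> (\<forall>Q\<in>S. refines V P Q)"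

(* Meaningful only for card P > 1. *)
definition phi :: "('i set \<Rightarrow> real) \<Rightarrow> 'i set \<Rightarrow> 'i set set \<Rightarrow> real" where
  "phi H V P = (\<Sum>C\<in>P. (H V - H C) / (real (card P) - 1))"

definition fundamental_partition :: "('i set \<Rightarrow> real) \<Rightarrow> 'i set \<Rightarrow> 'i set set \<Rightarrow> bool" where
  "fundamental_partition H V =
     finest_in V {P. is_arg_max (phi H V) (\<lambda>P. P \<in> proper_parts V) P}"

definition f_sharp :: "('i set \<Rightarrow> real) \<Rightarrow> 'i set \<Rightarrow> real \<Rightarrow> 'i set \<Rightarrow> real" where
  "f_sharp H V \<alpha> X = (if X = {} then 0 else \<alpha> - H V + H X)"

definition f_sharp_part :: "('i set \<Rightarrow> real) \<Rightarrow> 'i set \<Rightarrow> real \<Rightarrow> 'i set set \<Rightarrow> real" where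
  "f_sharp_part H V \<alpha> P = (\<Sum>C\<in>P. f_sharp H V \<alpha> C)"

(* At X = {} this is 0, because the only partition of {} is {}. *)
definition dilworth :: "('i set \<Rightarrow> real) \<Rightarrow> 'i set \<Rightarrow> real \<Rightarrow> 'i set \<Rightarrow> real" where
  "dilworth H V \<alpha> X = (MIN P\<in>parts X. f_sharp_part H V \<alpha> P)"

definition base_polytope :: "'i set \<Rightarrow> ('i set \<Rightarrow> real) \<Rightarrow> ('i \<Rightarrow> real) set" where
  "base_polytope V f = {r \<in> extensional V. (\<forall>X. X \<subseteq> V \<longrightarrow> sum r X \<le> f X) \<and> sum r V = f V}"

definition finest_minimizer :: "('i set \<Rightarrow> real) \<Rightarrow> 'i set \<Rightarrow> real \<Rightarrow> 'i set set \<Rightarrow> bool" where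
  "finest_minimizer H V \<alpha> =
     finest_in V {P. is_arg_min (f_sharp_part H V \<alpha>) (\<lambda>P. P \<in> parts V) P}"


(* The algorithm as a transition system (it is nondeterministic: any base vector may be
   picked).  A state is the content of the variables whenever the loop guard
   mda_hat \<noteq> mda_alpha is evaluated. *)

record 'i mda_state =
  mda_alpha :: real
  mda_part  :: "'i set set"
  mda_rate  :: "'i \<Rightarrow> real"
  mda_hat   :: real

definition mda_alpha0 :: "('i set \<Rightarrow> real) \<Rightarrow> 'i set \<Rightarrow> real" where
  "mda_alpha0 H V = max (MAX i\<in>V. phi H V {{i}, V - {i}}) (phi H V ((\<lambda>m. {m}) ` V))"

(* s is a possible result of the find-and-update instructions when alpha has value a. *)
definition mda_find :: "('i set \<Rightarrow> real) \<Rightarrow> 'i set \<Rightarrow> real \<Rightarrow> 'i mda_state \<Rightarrow> bool" where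
  "mda_find H V a s \<longleftrightarrow>
     mda_alpha s = a \<and>
     finest_minimizer H V a (mda_part s) \<and>
     mda_rate s \<in> base_polytope V (dilworth H V a) \<and>
     mda_hat s = phi H V (mda_part s)"

definition mda_init :: "('i set \<Rightarrow> real) \<Rightarrow> 'i set \<Rightarrow> 'i mda_state \<Rightarrow> bool" where
  "mda_init H V s \<longleftrightarrow> mda_find H V (mda_alpha0 H V) s"

definition mda_halted :: "'i mda_state \<Rightarrow> bool" where
  "mda_halted s \<longleftrightarrow> mda_hat s = mda_alpha s"

definition mda_step :: "('i set \<Rightarrow> real) \<Rightarrow> 'i set \<Rightarrow> 'i mda_state \<Rightarrow> 'i mda_state \<Rightarrow> bool" where
  "mda_step H V s s' \<longleftrightarrow> \<not> mda_halted s \<and> mda_find H V (mda_hat s) s'"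

(* A run, continued by repetition of the halting state if there is one. *)
definition mda_run :: "('i set \<Rightarrow> real) \<Rightarrow> 'i set \<Rightarrow> (nat \<Rightarrow> 'i mda_state) \<Rightarrow> bool" where
  "mda_run H V \<sigma> \<longleftrightarrow>
     mda_init H V (\<sigma> 0) \<and>
     (\<forall>k. if mda_halted (\<sigma> k) then \<sigma> (Suc k) = \<sigma> k else mda_step H V (\<sigma> k) (\<sigma> (Suc k)))"

end

theory Submission
  imports Defs
begin

text \<open>
  Since \<open>r(V) = \<alpha>\<close> turns \<open>r(V - C) \<ge> H(V - C | C)\<close> into
  \<open>r(C) \<le> f\<^sup>#\<^sub>\<alpha>(C)\<close>, sum rate \<open>\<alpha>\<close> is achievable iff the Dilworth truncation
  at \<open>V\<close> equals \<open>\<alpha>\<close>, that is, iff \<open>\<phi>(P) \<le> \<alpha>\<close> for all proper partitions \<open>P\<close>.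
  Strong subadditivity of the entropy makes \<open>f\<^sup>#\<^sub>\<alpha>\<close> submodular on intersecting pairs, so the
  tight sets of a feasible vector are closed under union and intersection of intersecting pairs;
  this gives both base vectors (raise the coordinates greedily until everything is covered by tight
  sets) and finest minimizers. Below the optimum, a minimizing partition has
  \<open>f\<^sup>#\<^sub>\<alpha>[P] = \<alpha> + (|P| - 1)(\<alpha> - \<phi>(P)) < \<alpha>\<close>, hence \<open>\<alpha> < \<phi>(P)\<close>: the estimates increase
  strictly through the finitely many values of \<open>\<phi>\<close> until they reach the maximum.
\<close>

section \<open>Submodularity of the joint entropy\<close>

text \<open>This is nonnegativity of the conditional mutual information I(X;Y|Z). All four entropies
  become integrals against the joint density \<open>Pxyz\<close> over one space, where the logarithm
  of the quotient can be split.\<close>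

lemma (in information_space) entropy_strongly_subadditive:
  fixes Pz :: "'d \<Rightarrow> real"
  assumes S: "sigma_finite_measure S" and T: "sigma_finite_measure T" and P: "sigma_finite_measure P"
  assumes Fx: "finite_entropy S X Px"
  assumes Fz: "finite_entropy P Z Pz"
  assumes Fyz: "finite_entropy (T \<Otimes>\<^sub>M P) (\<lambda>x. (Y x, Z x)) Pyz"
  assumes Fxz: "finite_entropy (S \<Otimes>\<^sub>M P) (\<lambda>x. (X x, Z x)) Pxz"
  assumes Fxyz: "finite_entropy (S \<Otimes>\<^sub>M T \<Otimes>\<^sub>M P) (\<lambda>x. (X x, Y x, Z x)) Pxyz"
  shows "entropy b (S \<Otimes>\<^sub>M T \<Otimes>\<^sub>M P) (\<lambda>x. (X x, Y x, Z x)) + entropy b P Z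
    \<le> entropy b (S \<Otimes>\<^sub>M P) (\<lambda>x. (X x, Z x)) + entropy b (T \<Otimes>\<^sub>M P) (\<lambda>x. (Y x, Z x))"
proof -
  let ?N = "S \<Otimes>\<^sub>M T \<Otimes>\<^sub>M P"
  \<comment> \<open>Pulls the density \<open>Qw\<close> of a marginal \<open>W\<close> back to the
    triple space along \<open>f\<close>. Integrability allows the integral to be split later; the
    almost-everywhere clause keeps the logarithms meaningful where \<open>Pxyz\<close> is
    positive.\<close>
  have fe: "integrable ?N (\<lambda>x. Pxyz x * log b (Qw (f x)))"
      "entropy b Q W = - (\<integral>x. Pxyz x * log b (Qw (f x)) \<partial>?N)"
      "AE x in ?N. Qw (f x) = 0 \<longrightarrow> Pxyz x = 0"
      "(\<lambda>x. Qw (f x)) \<in> borel_measurable ?N" "\<And>x. x \<in> space ?N \<Longrightarrow> 0 \<le> Qw (f x)"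
    if W: "finite_entropy Q W Qw" and eq: "W = (\<lambda>x. f (X x, Y x, Z x))" and f: "f \<in> measurable ?N Q"
    for Q :: "'e measure" and W Qw f
  proof -
    note Qw = finite_entropy_measurable[OF W]
    show "integrable ?N (\<lambda>x. Pxyz x * log b (Qw (f x)))"
      using finite_entropy_integrable_transform[OF W finite_entropy_distributed[OF Fxyz]
          finite_entropy_nn[OF Fxyz] eq f] by simp
    have "(\<integral>x. Qw x * log b (Qw x) \<partial>Q) = (\<integral>x. Pxyz x * log b (Qw (f x)) \<partial>?N)"
      using Qw
      by (intro distributed_transform_integral[OF finite_entropy_distributed[OF Fxyz]
          finite_entropy_nn[OF Fxyz] finite_entropy_distributed[OF W] finite_entropy_nn[OF W]])
        (auto simp: eq f comp_def)
    then show "entropy b Q W = - (\<integral>x. Pxyz x * log b (Qw (f x)) \<partial>?N)"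
      using entropy_distr[OF finite_entropy_distributed[OF W] finite_entropy_nn[OF W]] by simp
    show "AE x in ?N. Qw (f x) = 0 \<longrightarrow> Pxyz x = 0"
      using subdensity_finite_entropy[OF f Fxyz W] by (simp add: eq comp_def)
    show "(\<lambda>x. Qw (f x)) \<in> borel_measurable ?N"
      using measurable_compose[OF f Qw] .
    show "\<And>x. x \<in> space ?N \<Longrightarrow> 0 \<le> Qw (f x)"
      using finite_entropy_nn[OF W] measurable_space[OF f] by blast
  qed
  note z = fe[OF Fz, of "\<lambda>x. snd (snd x)", simplified]
  note yz = fe[OF Fyz, of snd, simplified]
  note xz = fe[OF Fxz, of "\<lambda>x. (fst x, snd (snd x))", simplified]
  note xyz = fe[OF Fxyz, of "\<lambda>x. x", simplified]
  note [measurable] = z(4) yz(4) xz(4) xyz(4)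
  have "0 \<le> conditional_mutual_information b S T P X Y Z"
    by (rule conditional_mutual_information_generic_nonneg'[OF S T P Fx Fz Fyz Fxz Fxyz])
  also have "\<dots> = (\<integral>x. Pxyz x * log b (Pxyz x / (Pxz (fst x, snd (snd x)) *
      (Pyz (snd x) / Pz (snd (snd x))))) \<partial>?N)"
    unfolding conditional_mutual_information_generic_eq'[OF S T P Fx Fz Fyz Fxz Fxyz]
    by (simp add: split_beta')
  also have "\<dots> = (\<integral>x. Pxyz x * log b (Pxyz x) + Pxyz x * log b (Pz (snd (snd x)))
      - Pxyz x * log b (Pxz (fst x, snd (snd x))) - Pxyz x * log b (Pyz (snd x)) \<partial>?N)"
  proof (rule integral_cong_AE)
    show "AE x in ?N. Pxyz x * log b (Pxyz x / (Pxz (fst x, snd (snd x)) *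
      (Pyz (snd x) / Pz (snd (snd x))))) = Pxyz x * log b (Pxyz x) + Pxyz x * log b (Pz (snd (snd x)))
      - Pxyz x * log b (Pxz (fst x, snd (snd x))) - Pxyz x * log b (Pyz (snd x))"
      using z(3) yz(3) xz(3) AE_space
    proof eventually_elim
      case (elim x)
      show ?case
      \<comment> \<open>Where \<open>Pxyz\<close> vanishes both sides are 0; elsewhere all four
        densities are positive and the logarithm splits.\<close>
      proof (cases "Pxyz x = 0")
        case False
        with elim have "Pz (snd (snd x)) > 0" "Pyz (snd x) > 0" "Pxz (fst x, snd (snd x)) > 0" "Pxyz x > 0"
          using z(5)[of x] yz(5)[of x] xz(5)[of x] xyz(5)[of x] by (auto simp: less_le)
        then show ?thesis
          by (simp add: log_mult log_divide algebra_simps)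
      qed simp
    qed
  qed measurable
  also have "\<dots> = (\<integral>x. Pxyz x * log b (Pxyz x) \<partial>?N) + (\<integral>x. Pxyz x * log b (Pz (snd (snd x))) \<partial>?N)
      - (\<integral>x. Pxyz x * log b (Pxz (fst x, snd (snd x))) \<partial>?N) - (\<integral>x. Pxyz x * log b (Pyz (snd x)) \<partial>?N)"
    using z(1) yz(1) xz(1) xyz(1) by simp
  finally show ?thesis
    using z(2) yz(2) xz(2) xyz(2) by simp
qed

text \<open>A bijection carries counting measure to counting measure, so the density is merely
  relabelled. This serves to identify the tuple over a disjoint union with the pair of its
  subtuples.\<close>

lemma (in information_space) finite_entropy_bij_count_space:
  assumes F: "finite_entropy (count_space A) X p" and f: "bij_betw f A B"
  shows "finite_entropy (count_space B) (\<lambda>\<omega>. f (X \<omega>)) (\<lambda>y. p (the_inv_into A f y))" (is ?fin)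
    and "entropy b (count_space B) (\<lambda>\<omega>. f (X \<omega>)) = entropy b (count_space A) X" (is ?ent)
proof -
  let ?g = "the_inv_into A f"
  have fm: "f \<in> measurable (count_space A) (count_space B)"
    using f by (auto simp: bij_betw_def)
  have gf: "?g (f x) = x" if "x \<in> A" for x
    using f that by (auto simp: bij_betw_def the_inv_into_f_f)
  have gB: "?g y \<in> A" if "y \<in> B" for y
    using bij_betw_the_inv_into[OF f] that by (auto simp: bij_betw_def)
  have B: "count_space B = distr (count_space A) (count_space B) f"
    using distr_bij_count_space[OF f] by simp
  note D = finite_entropy_distributed[OF F]
  note Xm = distributed_measurable[OF D]
  have "distr M (count_space B) (\<lambda>\<omega>. f (X \<omega>)) = distr (distr M (count_space A) X) (count_space B) f"
    using Xm fm by (simp add: distr_distr comp_def)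
  also have "\<dots> = distr (density (count_space A) (\<lambda>x. ennreal (p (?g (f x))))) (count_space B) f"
    unfolding distributed_distr_eq_density[OF D]
    by (intro arg_cong[where f="\<lambda>m. distr m _ _"] density_cong) (auto simp: gf AE_count_space)
  also have "\<dots> = density (distr (count_space A) (count_space B) f) (\<lambda>y. ennreal (p (?g y)))"
    using fm by (subst density_distr) auto
  also have "\<dots> = density (count_space B) (\<lambda>y. ennreal (p (?g y)))"
    using distr_bij_count_space[OF f] by simp
  finally have D': "distributed M (count_space B) (\<lambda>\<omega>. f (X \<omega>)) (\<lambda>y. ennreal (p (?g y)))"
    using measurable_compose[OF Xm fm] by (simp add: distributed_def)
  have nn: "0 \<le> p x" if "x \<in> A" for x
    using finite_entropy_nn[OF F] that by simp
  have "integrable (count_space B) (\<lambda>y. p (?g y) * log b (p (?g y)))"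
    by (subst B, subst integrable_distr_eq[OF fm], simp,
        rule Bochner_Integration.integrable_cong[THEN iffD1, OF refl _ finite_entropy_integrable[OF F]])
      (simp add: gf)
  with D' nn gB show ?fin
    by (auto simp: finite_entropy_def)
  have "(\<integral>y. p (?g y) * log b (p (?g y)) \<partial>count_space B) = (\<integral>x. p x * log b (p x) \<partial>count_space A)"
    by (subst B, subst integral_distr[OF fm]) (auto simp: gf intro!: Bochner_Integration.integral_cong)
  then show ?ent
    using entropy_distr[OF D] entropy_distr[OF D'] nn gB by simp
qed

lemma bij_betw_PiE_Times:
  assumes "I \<inter> J = {}"
  shows "bij_betw (\<lambda>f. (restrict f I, restrict f J)) (PiE (I \<union> J) A) (PiE I A \<times> PiE J A)"
  by (rule bij_betw_byWitness[where f'="merge I J"])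
    (use assms in \<open>auto simp: PiE_iff extensional_restrict\<close>)

text \<open>Strong subadditivity for the tuples over \<open>X - Y\<close> and \<open>Y - X\<close>,
  given the tuple over \<open>X \<inter> Y\<close>; what remains is to relabel tuples over unions as
  pairs and triples.\<close>

lemma joint_entropy_submodular:
  assumes inf: "information_space M b" and V: "finite V"
    and A: "\<And>i. i \<in> V \<Longrightarrow> countable (A i)"
    and F: "\<And>X. X \<subseteq> V \<Longrightarrow> finite_joint_entropy M b A Z X"
    and XY: "X \<subseteq> V" "Y \<subseteq> V"
  shows "joint_entropy M b A Z (X \<union> Y) + joint_entropy M b A Z (X \<inter> Y)
    \<le> joint_entropy M b A Z X + joint_entropy M b A Z Y"
proof -
  interpret information_space M b by fact
  define C where "C W = PiE W A" for W
  have cnt: "countable (C W)" if "W \<subseteq> V" for W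
    unfolding C_def using that V A by (intro countable_PiE) (auto intro: finite_subset)
  have F': "\<exists>p. finite_entropy (count_space (C W)) (tuple_rv Z W) p" if "W \<subseteq> V" for W
    using F[OF that] by (simp add: finite_joint_entropy_def tuple_space_def C_def)
  have je: "joint_entropy M b A Z W = entropy b (count_space (C W)) (tuple_rv Z W)" for W
    by (simp add: joint_entropy_def tuple_space_def C_def)
  define I where "I = X \<inter> Y"
  define D where "D = X - Y"
  define E where "E = Y - X"
  have sub: "I \<subseteq> V" "D \<subseteq> V" "E \<subseteq> V" "D \<union> I \<subseteq> V" "E \<union> I \<subseteq> V" "D \<union> (E \<union> I) \<subseteq> V"
    using XY by (auto simp: I_def D_def E_def)
  have dis: "D \<inter> I = {}" "E \<inter> I = {}" "D \<inter> (E \<union> I) = {}"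
    by (auto simp: I_def D_def E_def)
  have XYeq: "D \<union> I = X" "E \<union> I = Y" "D \<union> (E \<union> I) = X \<union> Y"
    by (auto simp: I_def D_def E_def)
  have EI: "E \<subseteq> Y" "I \<subseteq> Y" "D \<union> Y = X \<union> Y"
    by (auto simp: I_def D_def E_def)
  \<comment> \<open>The tuple alphabets are countable, so the product of their counting measures is
    again a counting measure.\<close>
  have pm: "count_space (C W) \<Otimes>\<^sub>M count_space (C W') = count_space (C W \<times> C W')"
    if "W \<subseteq> V" "W' \<subseteq> V" for W W'
    using that cnt by (intro pair_measure_countable) auto
  have pm3: "count_space (C D) \<Otimes>\<^sub>M count_space (C E) \<Otimes>\<^sub>M count_space (C I)
      = count_space (C D \<times> C E \<times> C I)"
    unfolding pm[OF sub(3,1)] using cnt sub by (intro pair_measure_countable) auto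
  have rs: "restrict (tuple_rv Z W' \<omega>) W = tuple_rv Z W \<omega>" if "W \<subseteq> W'" for W W' \<omega>
    using that by (auto simp: tuple_rv_def fun_eq_iff)
  have pair: "\<exists>p. finite_entropy (count_space (C W \<times> C W')) (\<lambda>\<omega>. (tuple_rv Z W \<omega>, tuple_rv Z W' \<omega>)) p"
    "entropy b (count_space (C W \<times> C W')) (\<lambda>\<omega>. (tuple_rv Z W \<omega>, tuple_rv Z W' \<omega>))
      = joint_entropy M b A Z (W \<union> W')"
    if W: "W \<inter> W' = {}" "W \<union> W' \<subseteq> V" for W W'
  proof -
    obtain p where p: "finite_entropy (count_space (C (W \<union> W'))) (tuple_rv Z (W \<union> W')) p"
      using F'[OF W(2)] by auto
    note * = finite_entropy_bij_count_space[OF p bij_betw_PiE_Times[OF W(1), of A, folded C_def]]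
    show "\<exists>p. finite_entropy (count_space (C W \<times> C W')) (\<lambda>\<omega>. (tuple_rv Z W \<omega>, tuple_rv Z W' \<omega>)) p"
      using *(1) by (auto simp: rs)
    show "entropy b (count_space (C W \<times> C W')) (\<lambda>\<omega>. (tuple_rv Z W \<omega>, tuple_rv Z W' \<omega>))
      = joint_entropy M b A Z (W \<union> W')"
      using *(2) by (simp add: rs je)
  qed
  obtain pxyz where pxyz:
    "finite_entropy (count_space (C D \<times> C (E \<union> I))) (\<lambda>\<omega>. (tuple_rv Z D \<omega>, tuple_rv Z (E \<union> I) \<omega>)) pxyz"
    using pair(1)[OF dis(3) sub(6)] by auto
  \<comment> \<open>Splits the second component of the pair over \<open>D\<close> and
    \<open>E \<union> I\<close>, which yields the nested triple required by
    \<open>entropy_strongly_subadditive\<close>.\<close>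
  have bij: "bij_betw (map_prod id (\<lambda>f. (restrict f E, restrict f I))) (C D \<times> C (E \<union> I)) (C D \<times> C E \<times> C I)"
    using bij_betw_PiE_Times[OF dis(2), of A, folded C_def]
    by (intro bij_betw_map_prod) auto
  have xyz: "\<exists>p. finite_entropy (count_space (C D \<times> C E \<times> C I)) (\<lambda>\<omega>. (tuple_rv Z D \<omega>, tuple_rv Z E \<omega>, tuple_rv Z I \<omega>)) p"
    "entropy b (count_space (C D \<times> C E \<times> C I)) (\<lambda>\<omega>. (tuple_rv Z D \<omega>, tuple_rv Z E \<omega>, tuple_rv Z I \<omega>))
      = joint_entropy M b A Z (X \<union> Y)"
    using finite_entropy_bij_count_space[OF pxyz bij] pair(2)[OF dis(3) sub(6)]
    by (auto simp: rs XYeq EI)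
  obtain px pz pxz pyz qxyz where
    "finite_entropy (count_space (C D)) (tuple_rv Z D) px"
    "finite_entropy (count_space (C I)) (tuple_rv Z I) pz"
    "finite_entropy (count_space (C E \<times> C I)) (\<lambda>\<omega>. (tuple_rv Z E \<omega>, tuple_rv Z I \<omega>)) pyz"
    "finite_entropy (count_space (C D \<times> C I)) (\<lambda>\<omega>. (tuple_rv Z D \<omega>, tuple_rv Z I \<omega>)) pxz"
    "finite_entropy (count_space (C D \<times> C E \<times> C I)) (\<lambda>\<omega>. (tuple_rv Z D \<omega>, tuple_rv Z E \<omega>, tuple_rv Z I \<omega>)) qxyz"
    using F'[OF sub(2)] F'[OF sub(1)] pair(1)[OF dis(2) sub(5)] pair(1)[OF dis(1) sub(4)] xyz(1) by blast
  note * = this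
  have "entropy b (count_space (C D) \<Otimes>\<^sub>M count_space (C E) \<Otimes>\<^sub>M count_space (C I))
        (\<lambda>\<omega>. (tuple_rv Z D \<omega>, tuple_rv Z E \<omega>, tuple_rv Z I \<omega>))
      + entropy b (count_space (C I)) (tuple_rv Z I)
    \<le> entropy b (count_space (C D) \<Otimes>\<^sub>M count_space (C I)) (\<lambda>\<omega>. (tuple_rv Z D \<omega>, tuple_rv Z I \<omega>))
      + entropy b (count_space (C E) \<Otimes>\<^sub>M count_space (C I)) (\<lambda>\<omega>. (tuple_rv Z E \<omega>, tuple_rv Z I \<omega>))"
    by (rule entropy_strongly_subadditive[OF _ _ _ *[folded pm[OF sub(2,1)] pm[OF sub(3,1)] pm3]])
      (intro sigma_finite_measure_count_space_countable cnt sub)+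
  then show ?thesis
    using pair(2)[OF dis(2) sub(5)] pair(2)[OF dis(1) sub(4)] xyz(2)
    unfolding pm3[unfolded pm[OF sub(3,1)]] pm[OF sub(2,1)] pm[OF sub(3,1)] XYeq je[symmetric] by (simp add: I_def)
qed

section \<open>Intersecting submodular set functions\<close>

text \<open>On an intersecting pair all four sets are nonempty, so the constant \<alpha> - H(V)
  cancels and \<open>f_sharp\<close> inherits the inequality. On a disjoint pair the value 0 of
  \<open>f_sharp\<close> at the empty set would upset this balance.\<close>

locale intersecting_submodular =
  fixes H :: "'i set \<Rightarrow> real" and V :: "'i set"
  assumes fin: "finite V" and card_V: "card V > 1"
    and submod: "\<lbrakk>X \<subseteq> V; Y \<subseteq> V; X \<inter> Y \<noteq> {}\<rbrakk> \<Longrightarrow> H (X \<union> Y) + H (X \<inter> Y) \<le> H X + H Y"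
begin

section \<open>Feasible vectors and their tight sets\<close>

definition feasible :: "real \<Rightarrow> ('i \<Rightarrow> real) \<Rightarrow> bool" where
  "feasible \<alpha> r \<longleftrightarrow> (\<forall>X. X \<subseteq> V \<longrightarrow> sum r X \<le> f_sharp H V \<alpha> X)"

definition tight :: "real \<Rightarrow> ('i \<Rightarrow> real) \<Rightarrow> 'i set \<Rightarrow> bool" where
  "tight \<alpha> r X \<longleftrightarrow> X \<subseteq> V \<and> X \<noteq> {} \<and> sum r X = f_sharp H V \<alpha> X"

lemma V_nonempty: "V \<noteq> {}"
  using card_V by auto

lemma finite_parts: "finite (parts V)"
  using finitely_many_partition_on[OF fin] by (simp add: parts_def)

lemma finite_parts_subset: "X \<subseteq> V \<Longrightarrow> finite (parts X)"
  using finitely_many_partition_on[of X] fin by (simp add: parts_def finite_subset)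

lemma parts_nonempty: "parts X \<noteq> {}"
  using partition_on_singletons[of X] by (auto simp: parts_def)

lemma trivial_part: "{V} \<in> parts V"
  using V_nonempty by (simp add: parts_def partition_on_space)

text \<open>The slacks of union and intersection are nonnegative by feasibility, and by
  submodularity they add up to at most the slacks of \<open>X\<close> and \<open>Y\<close>, which
  are 0.\<close>

lemma tight_Un_Int:
  assumes r: "feasible \<alpha> r" and X: "tight \<alpha> r X" and Y: "tight \<alpha> r Y" and XY: "X \<inter> Y \<noteq> {}"
  shows "tight \<alpha> r (X \<union> Y)" "tight \<alpha> r (X \<inter> Y)"
proof -
  have sub: "X \<subseteq> V" "Y \<subseteq> V" and ne: "X \<noteq> {}" "Y \<noteq> {}"
    using X Y by (auto simp: tight_def)
  have "sum r (X \<union> Y) + sum r (X \<inter> Y) = sum r X + sum r Y"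
    using sub fin by (intro sum.union_inter) (auto intro: finite_subset)
  moreover have "sum r X = f_sharp H V \<alpha> X" "sum r Y = f_sharp H V \<alpha> Y"
    using X Y by (auto simp: tight_def)
  moreover have "f_sharp H V \<alpha> (X \<union> Y) + f_sharp H V \<alpha> (X \<inter> Y) \<le> f_sharp H V \<alpha> X + f_sharp H V \<alpha> Y"
    using submod[OF sub XY] ne XY by (simp add: f_sharp_def)
  moreover have "sum r (X \<union> Y) \<le> f_sharp H V \<alpha> (X \<union> Y)"
    using r sub unfolding feasible_def by blast
  moreover have "sum r (X \<inter> Y) \<le> f_sharp H V \<alpha> (X \<inter> Y)"
    using r sub unfolding feasible_def by blast
  ultimately have "sum r (X \<union> Y) = f_sharp H V \<alpha> (X \<union> Y)" "sum r (X \<inter> Y) = f_sharp H V \<alpha> (X \<inter> Y)"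
    by linarith+
  then show "tight \<alpha> r (X \<union> Y)" "tight \<alpha> r (X \<inter> Y)"
    using sub XY by (auto simp: tight_def)
qed

lemma tight_Inter:
  assumes r: "feasible \<alpha> r" and "finite \<A>" "\<A> \<noteq> {}"
    and "\<And>X. X \<in> \<A> \<Longrightarrow> tight \<alpha> r X" and "\<Inter>\<A> \<noteq> {}"
  shows "tight \<alpha> r (\<Inter>\<A>)"
  using assms(2-)
proof (induction \<A> rule: finite_ne_induct)
  case (insert X \<A>)
  then show ?case
    using tight_Un_Int(2)[OF r, of X "\<Inter>\<A>"] by force
qed simp

section \<open>Greedy construction of vectors covered by tight sets\<close>

lemma feasible_exists: "\<exists>r. feasible \<alpha> r"
proof -
  \<comment> \<open>Including 0 makes \<open>K\<close> nonpositive, so that |X| K \<le> K for every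
    nonempty \<open>X\<close> and the constant vector \<open>K\<close> is feasible.\<close>
  define K where "K = Min (insert 0 (f_sharp H V \<alpha> ` Pow V))"
  have K: "K \<le> 0" "X \<subseteq> V \<Longrightarrow> K \<le> f_sharp H V \<alpha> X" for X
    unfolding K_def using fin by (auto intro!: Min_le)
  have "(\<Sum>i\<in>X. K) \<le> f_sharp H V \<alpha> X" if "X \<subseteq> V" for X
  proof (cases "X = {}")
    case False
    then have "card X \<ge> 1"
      using that fin by (simp add: Suc_le_eq card_gt_0_iff finite_subset)
    then have "real (card X) * K \<le> 1 * K"
      using K(1) by (intro mult_right_mono_neg) auto
    then show ?thesis using K(2)[OF that] by simp
  qed (simp add: f_sharp_def)
  then show ?thesis
    unfolding feasible_def by (intro exI[of _ "\<lambda>_. K"]) blast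
qed

text \<open>One greedy step: \<open>d\<close> is the least slack of a set containing
  \<open>j\<close>, so feasibility survives and a set attaining the minimum becomes tight.\<close>

lemma raise_coordinate:
  assumes r: "feasible \<alpha> r" and j: "j \<in> V"
  obtains d where "feasible \<alpha> (r(j := r j + d))" "\<exists>T. j \<in> T \<and> tight \<alpha> (r(j := r j + d)) T"
    "\<And>T. tight \<alpha> r T \<Longrightarrow> tight \<alpha> (r(j := r j + d)) T"
proof -
  define slack where "slack X = f_sharp H V \<alpha> X - sum r X" for X
  define \<X> where "\<X> = {X. X \<subseteq> V \<and> j \<in> X}"
  define d where "d = Min (slack ` \<X>)"
  define r' where "r' = r(j := r j + d)"
  have fin\<X>: "finite (slack ` \<X>)" and ne: "slack ` \<X> \<noteq> {}"
    using fin j by (auto simp: \<X>_def)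
  have slack_nn: "slack X \<ge> 0" if "X \<subseteq> V" for X
    using r that by (auto simp: slack_def feasible_def)
  have d_le: "d \<le> slack X" if "X \<subseteq> V" "j \<in> X" for X
    unfolding d_def using fin\<X> that by (auto simp: \<X>_def intro: Min_le)
  have "d \<ge> 0"
    unfolding d_def using fin\<X> ne slack_nn by (subst Min_ge_iff) (auto simp: \<X>_def)
  have sum_r': "sum r' X = sum r X + (if j \<in> X then d else 0)" if "X \<subseteq> V" for X
  proof (cases "j \<in> X")
    case True
    have "finite X" using that fin finite_subset by auto
    then show ?thesis
      using True by (simp add: r'_def sum.remove[of X j])
  next
    case False
    then show ?thesis unfolding r'_def by (auto intro: sum.cong)
  qed
  have "feasible \<alpha> r'"
    unfolding feasible_def
  proof (intro allI impI)
    fix X assume X: "X \<subseteq> V"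
    then show "sum r' X \<le> f_sharp H V \<alpha> X"
      using d_le[OF X] slack_nn[OF X] sum_r'[OF X] by (auto simp: slack_def)
  qed
  moreover have "\<exists>T. j \<in> T \<and> tight \<alpha> r' T"
  proof -
    have "d \<in> slack ` \<X>"
      unfolding d_def using Min_in[OF fin\<X> ne] .
    then obtain T where "T \<subseteq> V" "j \<in> T" "d = slack T"
      by (auto simp: \<X>_def)
    then show ?thesis
      using sum_r'[of T] by (auto simp: tight_def slack_def)
  qed
  \<comment> \<open>If \<open>j\<close> lies in \<open>T\<close>, the zero slack of \<open>T\<close>
    forces \<open>d = 0\<close>; otherwise the sum over \<open>T\<close> does not change.\<close>
  moreover have "tight \<alpha> r' T" if T: "tight \<alpha> r T" for T
  proof -
    have "T \<subseteq> V" "slack T = 0" using T by (auto simp: tight_def slack_def)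
    then have "sum r' T = sum r T"
      using sum_r'[of T] d_le[of T] \<open>d \<ge> 0\<close> by auto
    then show ?thesis using T by (simp add: tight_def)
  qed
  ultimately show ?thesis
    using that unfolding r'_def by blast
qed

text \<open>Coordinates are raised one after another; elements covered earlier stay covered because
  tight sets persist.\<close>

lemma feasible_covered_exists:
  "\<exists>r. feasible \<alpha> r \<and> (\<forall>i\<in>V. \<exists>T. i \<in> T \<and> tight \<alpha> r T)"
proof -
  have "\<exists>r. feasible \<alpha> r \<and> (\<forall>i\<in>W. \<exists>T. i \<in> T \<and> tight \<alpha> r T)" if "finite W" "W \<subseteq> V" for W
    using that
  proof (induction W rule: finite_induct)
    case empty
    then show ?case using feasible_exists by auto
  next
    case (insert j W)
    then obtain r where r: "feasible \<alpha> r" "\<forall>i\<in>W. \<exists>T. i \<in> T \<and> tight \<alpha> r T"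
      by auto
    obtain d where "feasible \<alpha> (r(j := r j + d))" "\<exists>T. j \<in> T \<and> tight \<alpha> (r(j := r j + d)) T"
      "\<And>T. tight \<alpha> r T \<Longrightarrow> tight \<alpha> (r(j := r j + d)) T"
      using raise_coordinate[OF r(1)] insert.prems by blast
    with r(2) show ?case
      by (intro exI[of _ "r(j := r j + d)"]) blast
  qed
  from this[OF fin subset_refl] show ?thesis .
qed

text \<open>The inclusion-maximal tight sets are the blocks: if two of them met, their union would
  be tight, so both would equal it.\<close>

lemma tight_partition:
  assumes r: "feasible \<alpha> r" and cover: "\<forall>i\<in>V. \<exists>T. i \<in> T \<and> tight \<alpha> r T"
  shows "\<exists>P\<in>parts V. \<forall>C\<in>P. tight \<alpha> r C"
proof -
  define \<T> where "\<T> = {T. tight \<alpha> r T}"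
  define P where "P = {T\<in>\<T>. \<forall>S\<in>\<T>. T \<subseteq> S \<longrightarrow> T = S}"
  have maximal: "T = S" if "T \<in> P" "S \<in> \<T>" "T \<subseteq> S" for T S
    using that by (simp add: P_def)
  have fin\<T>: "finite \<T>"
    using fin by (rule_tac finite_subset[of _ "Pow V"]) (auto simp: \<T>_def tight_def)
  have "partition_on V P"
  proof (rule partition_onI)
    show "\<Union> P = V"
    proof (intro equalityI subsetI)
      fix i assume "i \<in> V"
      then obtain T where "i \<in> T" "T \<in> \<T>" using cover by (auto simp: \<T>_def)
      then obtain S where "S \<in> \<T>" "T \<subseteq> S" "\<forall>S'\<in>\<T>. S \<subseteq> S' \<longrightarrow> S = S'"
        using finite_has_maximal2[OF fin\<T>] by metis
      then show "i \<in> \<Union> P"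
        using \<open>i \<in> T\<close> by (auto simp: P_def)
    qed (auto simp: P_def \<T>_def tight_def)
    show "disjnt S T" if "S \<in> P" "T \<in> P" "S \<noteq> T" for S T
    proof (rule ccontr)
      assume "\<not> disjnt S T"
      then have "S \<union> T \<in> \<T>"
        using that tight_Un_Int(1)[OF r] by (auto simp: P_def \<T>_def disjnt_def)
      then have "S = S \<union> T" "T = S \<union> T"
        using maximal[OF that(1)] maximal[OF that(2)] by simp_all
      with that(3) show False by simp
    qed
    show "{} \<notin> P" by (auto simp: P_def \<T>_def tight_def)
  qed
  then have "P \<in> parts V" by (simp add: parts_def)
  moreover have "\<forall>C\<in>P. tight \<alpha> r C" by (simp add: P_def \<T>_def)
  ultimately show ?thesis by blast
qed

section \<open>Dilworth truncation, base vectors and minimizing partitions\<close>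

lemma sum_partition:
  fixes r :: "'i \<Rightarrow> real"
  assumes P: "P \<in> parts X" and "X \<subseteq> V"
  shows "sum r X = (\<Sum>C\<in>P. sum r C)"
proof -
  have X: "X = \<Union>P" and "finite X"
    using assms fin by (auto simp: parts_def partition_on_def intro: finite_subset)
  then have "\<forall>A\<in>P. finite A"
    by (meson Sup_upper finite_subset)
  moreover have "\<forall>A\<in>P. \<forall>B\<in>P. A \<noteq> B \<longrightarrow> A \<inter> B = {}"
    using P unfolding parts_def partition_on_def disjoint_def by blast
  ultimately show ?thesis
    using sum.Union_disjoint[of P r] by (simp add: X)
qed

lemma dilworth_le: "X \<subseteq> V \<Longrightarrow> P \<in> parts X \<Longrightarrow> dilworth H V \<alpha> X \<le> f_sharp_part H V \<alpha> P"
  unfolding dilworth_def using finite_parts_subset by (intro Min_le) auto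

lemma dilworth_attained: "X \<subseteq> V \<Longrightarrow> \<exists>P\<in>parts X. dilworth H V \<alpha> X = f_sharp_part H V \<alpha> P"
proof -
  assume "X \<subseteq> V"
  then have "dilworth H V \<alpha> X \<in> f_sharp_part H V \<alpha> ` parts X"
    unfolding dilworth_def using finite_parts_subset parts_nonempty by (intro Min_in) auto
  then show ?thesis by blast
qed

lemma dilworth_le_f_sharp: "X \<subseteq> V \<Longrightarrow> dilworth H V \<alpha> X \<le> f_sharp H V \<alpha> X"
proof (cases "X = {}")
  case True
  have "{} \<in> parts ({} :: 'i set)" by (simp add: parts_def partition_on_empty)
  then show "X \<subseteq> V \<Longrightarrow> ?thesis"
    using dilworth_le[of "{}" "{}" \<alpha>] True by (simp add: f_sharp_part_def f_sharp_def)
next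
  case False
  then have "{X} \<in> parts X" by (simp add: parts_def partition_on_space)
  then show "X \<subseteq> V \<Longrightarrow> ?thesis"
    using dilworth_le[of X "{X}" \<alpha>] by (simp add: f_sharp_part_def)
qed

lemma feasible_le_part:
  assumes "feasible \<alpha> r" "X \<subseteq> V" "P \<in> parts X"
  shows "sum r X \<le> f_sharp_part H V \<alpha> P"
proof -
  have "sum r C \<le> f_sharp H V \<alpha> C" if "C \<in> P" for C
    using assms that unfolding feasible_def parts_def partition_on_def by blast
  then show ?thesis
    using sum_partition[OF assms(3,2)] by (simp add: f_sharp_part_def sum_mono)
qed

lemma feasible_le_dilworth:
  assumes "feasible \<alpha> r" "X \<subseteq> V"
  shows "sum r X \<le> dilworth H V \<alpha> X"
  using dilworth_attained[OF assms(2), of \<alpha>] feasible_le_part[OF assms] by auto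

text \<open>Bounding by the truncation or by \<open>f_sharp\<close> itself cuts out the same
  vectors: the truncation is the smaller function, and conversely bounds on the blocks of a
  partition add up.\<close>

lemma base_polytope_iff:
  "r \<in> base_polytope V (dilworth H V \<alpha>)
    \<longleftrightarrow> r \<in> extensional V \<and> feasible \<alpha> r \<and> sum r V = dilworth H V \<alpha> V"
proof
  assume r: "r \<in> base_polytope V (dilworth H V \<alpha>)"
  then have "feasible \<alpha> r"
    unfolding base_polytope_def feasible_def
    using order_trans[OF _ dilworth_le_f_sharp] by blast
  with r show "r \<in> extensional V \<and> feasible \<alpha> r \<and> sum r V = dilworth H V \<alpha> V"
    by (simp add: base_polytope_def)
next
  assume "r \<in> extensional V \<and> feasible \<alpha> r \<and> sum r V = dilworth H V \<alpha> V"
  then show "r \<in> base_polytope V (dilworth H V \<alpha>)"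
    unfolding base_polytope_def using feasible_le_dilworth by auto
qed

text \<open>For a partition \<open>P\<close> into tight sets, r(V) equals the value of
  \<open>P\<close>. The truncation at \<open>V\<close> lies between r(V) and that value, so all
  three agree.\<close>

lemma base_polytope_nonempty: "base_polytope V (dilworth H V \<alpha>) \<noteq> {}"
proof -
  obtain r where r: "feasible \<alpha> r" "\<forall>i\<in>V. \<exists>T. i \<in> T \<and> tight \<alpha> r T"
    using feasible_covered_exists by blast
  obtain P where P: "P \<in> parts V" "\<forall>C\<in>P. tight \<alpha> r C"
    using tight_partition[OF r] by blast
  have "sum r V = f_sharp_part H V \<alpha> P"
    using sum_partition[OF P(1) subset_refl, of r] P(2) by (simp add: f_sharp_part_def tight_def)
  then have "sum r V = dilworth H V \<alpha> V"
    using dilworth_le[OF subset_refl P(1), of \<alpha>] feasible_le_dilworth[OF r(1) subset_refl] by simp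
  \<comment> \<open>The greedy vector need not be extensional; restricting it to \<open>V\<close>
    leaves all relevant sums unchanged.\<close>
  moreover have *: "sum (restrict r V) X = sum r X" if "X \<subseteq> V" for X
    using that by (intro sum.cong) auto
  moreover have "feasible \<alpha> (restrict r V)"
    using r(1) * by (auto simp: feasible_def)
  ultimately have "restrict r V \<in> base_polytope V (dilworth H V \<alpha>)"
    by (simp add: base_polytope_iff)
  then show ?thesis by blast
qed

lemma is_arg_min_iff:
  "is_arg_min (f_sharp_part H V \<alpha>) (\<lambda>P. P \<in> parts V) P
    \<longleftrightarrow> P \<in> parts V \<and> f_sharp_part H V \<alpha> P = dilworth H V \<alpha> V"
proof -
  obtain Q where "Q \<in> parts V" "f_sharp_part H V \<alpha> Q = dilworth H V \<alpha> V"
    using dilworth_attained[OF subset_refl, of \<alpha>] by auto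
  then show ?thesis
    using dilworth_le[OF subset_refl, of _ \<alpha>] by (force simp: is_arg_min_linorder)
qed

text \<open>The gap between the value of \<open>P\<close> and r(V) is the sum of the nonnegative
  slacks of the blocks. A single base vector thus recognizes all minimizers at once.\<close>

lemma minimizer_iff_tight:
  assumes r: "r \<in> base_polytope V (dilworth H V \<alpha>)" and P: "P \<in> parts V"
  shows "f_sharp_part H V \<alpha> P = dilworth H V \<alpha> V \<longleftrightarrow> (\<forall>C\<in>P. tight \<alpha> r C)"
proof -
  have fP: "finite P"
    using P fin by (auto simp: parts_def intro: finite_elements)
  have C: "C \<subseteq> V" "C \<noteq> {}" if "C \<in> P" for C
    using P that by (auto simp: parts_def partition_on_def)
  have le: "sum r C \<le> f_sharp H V \<alpha> C" if "C \<in> P" for C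
    using r C[OF that] by (simp add: base_polytope_iff feasible_def)
  have "f_sharp_part H V \<alpha> P = dilworth H V \<alpha> V \<longleftrightarrow> (\<Sum>C\<in>P. f_sharp H V \<alpha> C - sum r C) = 0"
    using r sum_partition[OF P subset_refl, of r]
    by (auto simp: base_polytope_iff f_sharp_part_def sum_subtractf)
  also have "\<dots> \<longleftrightarrow> (\<forall>C\<in>P. tight \<alpha> r C)"
    using fP le C by (subst sum_nonneg_eq_0_iff) (auto simp: tight_def)
  finally show ?thesis .
qed

lemma finest_minimizer_exists: "\<exists>P. finest_minimizer H V \<alpha> P"
proof -
  \<comment> \<open>The blocks of every minimizer are tight for one and the same base vector, so their
    nonempty intersections are tight as well: the common refinement is again a minimizer.\<close>
  define \<P> where "\<P> = {P. is_arg_min (f_sharp_part H V \<alpha>) (\<lambda>P. P \<in> parts V) P}"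
  obtain r where r: "r \<in> base_polytope V (dilworth H V \<alpha>)"
    using base_polytope_nonempty by blast
  have \<P>: "partition_on V P" if "P \<in> \<P>" for P
    using that unfolding \<P>_def is_arg_min_iff by (simp add: parts_def)
  have ne: "\<P> \<noteq> {}"
    using dilworth_attained[OF subset_refl, of \<alpha>] by (auto simp: \<P>_def is_arg_min_iff)
  have fin\<P>: "finite \<P>"
    using finite_parts by (rule rev_finite_subset) (auto simp: \<P>_def is_arg_min_iff)
  have "tight \<alpha> r C" if "C \<in> common_refinement \<P>" for C
  proof -
    from that obtain f where f: "f \<in> (\<Pi> P\<in>\<P>. P)" "C = \<Inter>(f ` \<P>)" "C \<noteq> {}"
      by (auto simp: common_refinement)
    have "tight \<alpha> r (f P)" if "P \<in> \<P>" for P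
      using f(1) that minimizer_iff_tight[OF r, of P] by (auto simp: \<P>_def is_arg_min_iff)
    then show ?thesis
      using r f(2,3) fin\<P> ne by (auto intro!: tight_Inter simp: base_polytope_iff)
  qed
  moreover have "common_refinement \<P> \<in> parts V"
    using partition_on_common_refinement[OF \<P> ne] by (simp add: parts_def)
  ultimately have "common_refinement \<P> \<in> \<P>"
    using minimizer_iff_tight[OF r] by (simp add: \<P>_def is_arg_min_iff)
  then have "finest_in V \<P> (common_refinement \<P>)"
    using refines_common_refinement[OF \<P>] by (simp add: finest_in_def)
  then show ?thesis
    by (auto simp: finest_minimizer_def \<P>_def)
qed

lemma mda_find_exists: "\<exists>s. mda_find H V a s"
proof -
  obtain P r where "finest_minimizer H V a P" "r \<in> base_polytope V (dilworth H V a)"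
    using finest_minimizer_exists base_polytope_nonempty by blast
  then have "mda_find H V a \<lparr>mda_alpha = a, mda_part = P, mda_rate = r, mda_hat = phi H V P\<rparr>"
    by (simp add: mda_find_def)
  then show ?thesis by blast
qed

section \<open>Comparison of the truncation with \<open>phi\<close>\<close>

lemma parts_cases: "P \<in> parts V \<Longrightarrow> P = {V} \<or> P \<in> proper_parts V"
proof -
  assume P: "P \<in> parts V"
  then have "finite P" using fin by (auto simp: parts_def intro: finite_elements)
  moreover have "P \<noteq> {}" using P V_nonempty by (auto simp: parts_def partition_on_def)
  ultimately have "card P > 0" by (simp add: card_gt_0_iff)
  then consider "card P = 1" | "card P > 1" by linarith
  then show ?thesis
  proof cases
    case 1
    then obtain C where "P = {C}" by (auto simp: card_1_singleton_iff)
    then show ?thesis using P by (auto simp: parts_def partition_on_def)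
  qed (use P in \<open>simp add: proper_parts_def\<close>)
qed

text \<open>As a function of \<alpha> this is a line of slope |P| that meets the diagonal at
  \<open>phi H V P\<close>. Replacing \<alpha> by \<open>phi\<close> of a minimizer is therefore a
  Newton step towards the point from which the truncation at \<open>V\<close> equals
  \<alpha>.\<close>

lemma f_sharp_part_eq_phi:
  assumes "P \<in> proper_parts V"
  shows "f_sharp_part H V \<alpha> P = \<alpha> + (real (card P) - 1) * (\<alpha> - phi H V P)"
proof -
  have "card P > 1" "{} \<notin> P"
    using assms by (auto simp: proper_parts_def parts_def partition_on_def)
  then have phi: "(real (card P) - 1) * phi H V P = (\<Sum>C\<in>P. H V - H C)"
    by (simp add: phi_def sum_divide_distrib[symmetric])
  have "f_sharp_part H V \<alpha> P = (\<Sum>C\<in>P. \<alpha> - (H V - H C))"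
    unfolding f_sharp_part_def using \<open>{} \<notin> P\<close> by (intro sum.cong) (auto simp: f_sharp_def)
  also have "\<dots> = real (card P) * \<alpha> - (real (card P) - 1) * phi H V P"
    using phi by (simp add: sum_subtractf)
  finally show ?thesis by (simp add: algebra_simps)
qed

lemma f_sharp_part_trivial: "f_sharp_part H V \<alpha> {V} = \<alpha>"
  using V_nonempty by (simp add: f_sharp_part_def f_sharp_def)

lemma f_sharp_part_cmp:
  assumes "P \<in> proper_parts V"
  shows "f_sharp_part H V \<alpha> P < \<alpha> \<longleftrightarrow> \<alpha> < phi H V P" "f_sharp_part H V \<alpha> P = \<alpha> \<longleftrightarrow> phi H V P = \<alpha>"
proof -
  have "real (card P) - 1 > 0" using assms by (simp add: proper_parts_def)
  then show "f_sharp_part H V \<alpha> P < \<alpha> \<longleftrightarrow> \<alpha> < phi H V P" "f_sharp_part H V \<alpha> P = \<alpha> \<longleftrightarrow> phi H V P = \<alpha>"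
    by (auto simp: f_sharp_part_eq_phi[OF assms] mult_less_0_iff)
qed

text \<open>The target value of the algorithm, identified with the minimum sum rate in
  \<open>R_ACO_eq\<close>.\<close>

definition phi_max :: real where
  "phi_max = Max (phi H V ` proper_parts V)"

lemma singletons_proper: "(\<lambda>m. {m}) ` V \<in> proper_parts V"
  using partition_on_singletons[of V] card_V by (simp add: proper_parts_def parts_def card_image)

lemma finite_proper_parts: "finite (proper_parts V)"
  using finite_parts by (simp add: proper_parts_def)

lemma phi_le_max: "P \<in> proper_parts V \<Longrightarrow> phi H V P \<le> phi_max"
  unfolding phi_max_def using finite_proper_parts by (intro Max_ge) auto

lemma phi_max_attained: "\<exists>P\<in>proper_parts V. phi H V P = phi_max"
proof -
  have "phi_max \<in> phi H V ` proper_parts V"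
    unfolding phi_max_def using finite_proper_parts singletons_proper by (intro Max_in) auto
  then show ?thesis by force
qed

lemma dilworth_le_alpha: "dilworth H V \<alpha> V \<le> \<alpha>"
  using dilworth_le[OF subset_refl trivial_part] by (simp add: f_sharp_part_trivial)

text \<open>The trivial partition \<open>{V}\<close> has value \<alpha>, so equality means that no
  proper partition falls below \<alpha>.\<close>

lemma dilworth_eq_alpha_iff: "dilworth H V \<alpha> V = \<alpha> \<longleftrightarrow> phi_max \<le> \<alpha>"
proof
  assume "dilworth H V \<alpha> V = \<alpha>"
  obtain P where "P \<in> proper_parts V" "phi H V P = phi_max"
    using phi_max_attained by blast
  then show "phi_max \<le> \<alpha>"
    using \<open>dilworth H V \<alpha> V = \<alpha>\<close> dilworth_le[OF subset_refl, of P \<alpha>] f_sharp_part_cmp(1)[of P \<alpha>]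
    by (auto simp: proper_parts_def)
next
  assume *: "phi_max \<le> \<alpha>"
  obtain P where P: "P \<in> parts V" "dilworth H V \<alpha> V = f_sharp_part H V \<alpha> P"
    using dilworth_attained[OF subset_refl] by blast
  have "\<alpha> \<le> f_sharp_part H V \<alpha> P"
    using parts_cases[OF P(1)]
  proof
    assume "P \<in> proper_parts V"
    then show ?thesis
      using f_sharp_part_cmp(1)[of P \<alpha>] phi_le_max[of P] * by force
  qed (simp add: f_sharp_part_trivial)
  then show "dilworth H V \<alpha> V = \<alpha>"
    using P dilworth_le_alpha[of \<alpha>] by simp
qed

section \<open>The rate region and the minimum sum rate\<close>

text \<open>Complementation matches the proper subsets \<open>X\<close> of \<open>V\<close> with the
  nonempty sets \<open>C\<close>; at the empty set feasibility is trivial. The parameter \<alpha> is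
  the sum rate of \<open>r\<close> itself.\<close>

lemma R_CO_iff_feasible:
  assumes "r \<in> extensional V"
  shows "r \<in> R_CO H V \<longleftrightarrow> feasible (sum r V) r"
proof -
  have compl: "cond_entropy H (V - C) C \<le> sum r (V - C) \<longleftrightarrow> sum r C \<le> f_sharp H V (sum r V) C"
    if "C \<subseteq> V" "C \<noteq> {}" for C
  proof -
    have "V - C \<union> C = V" using that by auto
    then show ?thesis
      using that fin by (auto simp: cond_entropy_def f_sharp_def sum_diff)
  qed
  show ?thesis
  proof
    assume r: "r \<in> R_CO H V"
    show "feasible (sum r V) r"
      unfolding feasible_def
    proof (intro allI impI)
      fix C assume C: "C \<subseteq> V"
      show "sum r C \<le> f_sharp H V (sum r V) C"
      proof (cases "C = {}")
        case False
        then have "V - C \<subset> V" "V - (V - C) = C" using C by auto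
        then have "cond_entropy H (V - C) C \<le> sum r (V - C)"
          using r by (auto simp: R_CO_def)
        then show ?thesis using compl[OF C False] by simp
      qed (simp add: f_sharp_def)
    qed
  next
    assume r: "feasible (sum r V) r"
    have "cond_entropy H X (V - X) \<le> sum r X" if "X \<subset> V" for X
    proof -
      have "V - X \<subseteq> V" "V - X \<noteq> {}" "V - (V - X) = X" using that by auto
      then show ?thesis
        using compl[of "V - X"] r by (simp add: feasible_def)
    qed
    then show "r \<in> R_CO H V"
      using assms by (simp add: R_CO_def)
  qed
qed

lemma base_polytope_phi_max:
  assumes "r \<in> base_polytope V (dilworth H V phi_max)"
  shows "r \<in> R_CO H V" "sum r V = phi_max"
proof -
  show "sum r V = phi_max"
    using assms dilworth_eq_alpha_iff[of phi_max] by (simp add: base_polytope_iff)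
  then show "r \<in> R_CO H V"
    using assms R_CO_iff_feasible[of r] by (simp add: base_polytope_iff)
qed

text \<open>Feasibility at the vector's own sum rate bounds r(V) by the truncation at
  \<open>V\<close>, which never exceeds that parameter; hence equality.\<close>

lemma R_CO_sum_ge:
  assumes "r \<in> R_CO H V"
  shows "phi_max \<le> sum r V"
proof -
  have "feasible (sum r V) r"
    using assms R_CO_iff_feasible[of r] by (auto simp: R_CO_def)
  then have "dilworth H V (sum r V) V = sum r V"
    using feasible_le_dilworth[of "sum r V" r V] dilworth_le_alpha[of "sum r V"] by simp
  then show ?thesis by (simp add: dilworth_eq_alpha_iff)
qed

text \<open>A base vector at \<open>phi_max\<close> attains the lower bound, so the infimum is a
  minimum.\<close>

lemma R_ACO_eq: "R_ACO H V = phi_max"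
proof -
  obtain r where "r \<in> base_polytope V (dilworth H V phi_max)"
    using base_polytope_nonempty by blast
  then have "phi_max \<in> (\<lambda>r. sum r V) ` R_CO H V"
    using base_polytope_phi_max by (metis image_eqI)
  then show ?thesis
    unfolding R_ACO_def using R_CO_sum_ge by (intro cInf_eq_minimum) auto
qed

section \<open>Minimizing partitions below and at the optimum\<close>

lemma finest_minimizer_below:
  assumes "\<alpha> < phi_max" "finest_minimizer H V \<alpha> P"
  shows "P \<in> proper_parts V" "\<alpha> < phi H V P"
proof -
  have P: "P \<in> parts V" "f_sharp_part H V \<alpha> P = dilworth H V \<alpha> V"
    using assms(2) unfolding finest_minimizer_def finest_in_def mem_Collect_eq is_arg_min_iff by simp_all
  then have "f_sharp_part H V \<alpha> P < \<alpha>"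
    using dilworth_eq_alpha_iff[of \<alpha>] dilworth_le_alpha[of \<alpha>] assms(1) by linarith
  then show "P \<in> proper_parts V" "\<alpha> < phi H V P"
    using parts_cases[OF P(1)] f_sharp_part_trivial[of \<alpha>] f_sharp_part_cmp(1)[of P \<alpha>] by auto
qed

text \<open>At the optimum the minimizers are the maximizers of \<open>phi\<close> together with the
  trivial partition. The finest one refines some maximizer, so it is not \<open>{V}\<close> and is
  the finest maximizer.\<close>

lemma finest_minimizer_phi_max:
  assumes P: "finest_minimizer H V phi_max P"
  shows "fundamental_partition H V P" "phi H V P = phi_max"
proof -
  have min_iff: "is_arg_min (f_sharp_part H V phi_max) (\<lambda>P. P \<in> parts V) Q
      \<longleftrightarrow> phi H V Q = phi_max" if "Q \<in> proper_parts V" for Q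
    using that f_sharp_part_cmp(2)[OF that, of phi_max] dilworth_eq_alpha_iff[of phi_max]
    by (auto simp: is_arg_min_iff proper_parts_def)
  have max_iff: "is_arg_max (phi H V) (\<lambda>P. P \<in> proper_parts V) Q
      \<longleftrightarrow> Q \<in> proper_parts V \<and> phi H V Q = phi_max" for Q
  proof -
    obtain Q' where "Q' \<in> proper_parts V" "phi H V Q' = phi_max"
      using phi_max_attained by blast
    then show ?thesis
      using phi_le_max by (force simp: is_arg_max_linorder)
  qed
  have Pmin: "is_arg_min (f_sharp_part H V phi_max) (\<lambda>P. P \<in> parts V) P"
    and Pref: "\<And>Q. is_arg_min (f_sharp_part H V phi_max) (\<lambda>P. P \<in> parts V) Q \<Longrightarrow> refines V P Q"
    using P by (auto simp: finest_minimizer_def finest_in_def)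
  have "P \<in> proper_parts V"
  proof -
    obtain Q where Q: "Q \<in> proper_parts V" "phi H V Q = phi_max"
      using phi_max_attained by blast
    then have "refines V P Q" using Pref min_iff by blast
    \<comment> \<open>A block of \<open>Q\<close> containing \<open>V\<close> is \<open>V\<close>
      itself, and any further block would be a nonempty set overlapping it.\<close>
    moreover have "\<not> refines V {V} Q"
    proof
      assume "refines V {V} Q"
      then obtain Y where "Y \<in> Q" "V \<subseteq> Y" by (auto simp: refines_def)
      have "\<Union>Q = V" using Q(1) by (simp add: proper_parts_def parts_def partition_on_def)
      have "V \<in> Q" using \<open>Y \<in> Q\<close> \<open>V \<subseteq> Y\<close> \<open>\<Union>Q = V\<close> by (metis Sup_upper subset_antisym)
      moreover have "Q \<noteq> {V}" using Q(1) by (auto simp: proper_parts_def)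
      ultimately obtain C where "C \<in> Q" "C \<noteq> V" by blast
      then show False
        using \<open>V \<in> Q\<close> \<open>\<Union>Q = V\<close> partition_onD2[of V Q] partition_onD3[of V Q] Q(1)
        unfolding proper_parts_def parts_def disjoint_def
        by (metis (lifting) Int_absorb2 Sup_upper mem_Collect_eq)
    qed
    ultimately show ?thesis
      using Pmin parts_cases[of P] unfolding is_arg_min_iff by blast
  qed
  then show "phi H V P = phi_max" using Pmin min_iff by blast
  with \<open>P \<in> proper_parts V\<close> show "fundamental_partition H V P"
    unfolding fundamental_partition_def finest_in_def using max_iff min_iff Pref by blast
qed

section \<open>Progress, correctness and termination of the algorithm\<close>

lemma mda_alpha0_le: "mda_alpha0 H V \<le> phi_max"
proof -
  have "phi H V {{i}, V - {i}} \<le> phi_max" if i: "i \<in> V" for i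
  proof (rule phi_le_max)
    \<comment> \<open>With at least two elements in \<open>V\<close>, the two blocks are nonempty
      and distinct, so the starting value is a maximum of values of \<open>phi\<close> on proper
      partitions.\<close>
    have "V \<noteq> {i}" using card_V by auto
    then have "V - {i} \<noteq> {}" "{i} \<noteq> V - {i}" using i by auto
    then show "{{i}, V - {i}} \<in> proper_parts V"
      using i by (auto simp: proper_parts_def parts_def partition_on_def disjoint_def)
  qed
  then show ?thesis
    unfolding mda_alpha0_def using fin V_nonempty phi_le_max[OF singletons_proper] by simp
qed

text \<open>The bound \<open>a \<le> phi_max\<close> is the loop invariant: below
  \<open>phi_max\<close> the estimate strictly grows, at \<open>phi_max\<close> it is a fixed point.
  The last claim confines new estimates to a finite set, for termination.\<close>

lemma mda_find_progress:
  assumes "mda_find H V a s" "a \<le> phi_max"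
  shows "mda_hat s \<le> phi_max" "a \<le> mda_hat s" "mda_halted s \<longleftrightarrow> a = phi_max"
    "a < phi_max \<Longrightarrow> mda_hat s \<in> phi H V ` proper_parts V"
proof -
  have s: "finest_minimizer H V a (mda_part s)" "mda_hat s = phi H V (mda_part s)" "mda_alpha s = a"
    using assms(1) by (auto simp: mda_find_def)
  consider "a < phi_max" | "a = phi_max" using assms(2) by linarith
  then have "mda_hat s \<le> phi_max \<and> a \<le> mda_hat s \<and> (mda_halted s \<longleftrightarrow> a = phi_max)
    \<and> (a < phi_max \<longrightarrow> mda_hat s \<in> phi H V ` proper_parts V)"
  proof cases
    case 1
    then show ?thesis
      using finest_minimizer_below[OF 1 s(1)] s phi_le_max by (auto simp: mda_halted_def)
  next
    case 2
    then show ?thesis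
      using finest_minimizer_phi_max(2) s by (auto simp: mda_halted_def)
  qed
  then show "mda_hat s \<le> phi_max" "a \<le> mda_hat s" "mda_halted s \<longleftrightarrow> a = phi_max"
    "a < phi_max \<Longrightarrow> mda_hat s \<in> phi H V ` proper_parts V"
    by auto
qed

lemma mda_find_halted:
  assumes "mda_find H V a s" "a \<le> phi_max" "mda_halted s"
  shows "mda_alpha s = R_ACO H V" "fundamental_partition H V (mda_part s)" "mda_rate s \<in> opt_rates H V"
proof -
  have [simp]: "a = phi_max" using mda_find_progress(3)[OF assms(1,2)] assms(3) by simp
  have s: "finest_minimizer H V phi_max (mda_part s)" "mda_alpha s = phi_max"
      "mda_rate s \<in> base_polytope V (dilworth H V phi_max)"
    using assms(1) by (auto simp: mda_find_def)
  then show "mda_alpha s = R_ACO H V" "fundamental_partition H V (mda_part s)" "mda_rate s \<in> opt_rates H V"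
    using finest_minimizer_phi_max(1) base_polytope_phi_max by (auto simp: R_ACO_eq opt_rates_def)
qed

lemma mda_run_0: "mda_run H V \<sigma> \<Longrightarrow> mda_find H V (mda_alpha0 H V) (\<sigma> 0)"
  by (simp add: mda_run_def mda_init_def)

lemma mda_run_stop: "mda_run H V \<sigma> \<Longrightarrow> mda_halted (\<sigma> k) \<Longrightarrow> \<sigma> (Suc k) = \<sigma> k"
  unfolding mda_run_def by presburger

lemma mda_run_continue:
  "mda_run H V \<sigma> \<Longrightarrow> \<not> mda_halted (\<sigma> k) \<Longrightarrow> mda_find H V (mda_hat (\<sigma> k)) (\<sigma> (Suc k))"
  unfolding mda_run_def mda_step_def by presburger

lemma mda_find_alpha: "mda_find H V a s \<Longrightarrow> mda_alpha s = a"
  by (simp add: mda_find_def)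

lemma mda_run_find:
  assumes "mda_run H V \<sigma>"
  shows "mda_find H V (mda_alpha (\<sigma> k)) (\<sigma> k) \<and> mda_alpha (\<sigma> k) \<le> phi_max"
proof (induction k)
  case 0
  then show ?case
    using mda_run_0[OF assms] mda_alpha0_le by (simp add: mda_find_alpha)
next
  case (Suc k)
  show ?case
  proof (cases "mda_halted (\<sigma> k)")
    case True
    then show ?thesis using Suc mda_run_stop[OF assms] by simp
  next
    case False
    then have "mda_find H V (mda_hat (\<sigma> k)) (\<sigma> (Suc k))"
      by (rule mda_run_continue[OF assms])
    moreover have "mda_hat (\<sigma> k) \<le> phi_max"
      using Suc mda_find_progress(1) by blast
    ultimately show ?thesis by (simp add: mda_find_alpha)
  qed
qed

text \<open>This also covers the repeated halting state, where \<open>mda_hat\<close> and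
  \<open>mda_alpha\<close> agree.\<close>

lemma mda_run_Suc:
  assumes "mda_run H V \<sigma>"
  shows "mda_alpha (\<sigma> (Suc k)) = mda_hat (\<sigma> k)"
proof (cases "mda_halted (\<sigma> k)")
  case True
  then show ?thesis using mda_run_stop[OF assms True] by (simp add: mda_halted_def)
next
  case False
  then show ?thesis using mda_run_continue[OF assms] mda_find_alpha by blast
qed

lemma mda_run_mono:
  assumes "mda_run H V \<sigma>"
  shows "mono (\<lambda>k. mda_alpha (\<sigma> k))"
  unfolding mono_iff_le_Suc mda_run_Suc[OF assms]
  using mda_find_progress(2) mda_run_find[OF assms] by blast

text \<open>An endless run would make the estimates strictly increasing and so embed the naturals
  into the finitely many values of \<open>phi\<close> on proper partitions.\<close>

lemma mda_run_halts:
  assumes "mda_run H V \<sigma>"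
  shows "\<exists>N. mda_halted (\<sigma> N)"
proof (rule ccontr)
  assume "\<not> ?thesis"
  then have nh: "\<not> mda_halted (\<sigma> k)" for k by blast
  note find = mda_run_find[OF assms]
  have lt: "mda_alpha (\<sigma> k) < phi_max" for k
    using mda_find_progress(3)[of _ "\<sigma> k"] find[of k] nh[of k] by (metis order_le_less)
  have "strict_mono (\<lambda>k. mda_hat (\<sigma> k))"
  proof (rule strict_monoI_Suc)
    fix k
    show "mda_hat (\<sigma> k) < mda_hat (\<sigma> (Suc k))"
      using mda_find_progress(2)[of "mda_alpha (\<sigma> (Suc k))" "\<sigma> (Suc k)"] find[of "Suc k"]
        nh[of "Suc k"] mda_run_Suc[OF assms, of k]
      by (simp add: mda_halted_def)
  qed
  then have "inj (\<lambda>k. mda_hat (\<sigma> k))" by (rule strict_mono_imp_inj_on)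
  moreover have "range (\<lambda>k. mda_hat (\<sigma> k)) \<subseteq> phi H V ` proper_parts V"
    using mda_find_progress(4) find lt by blast
  moreover have "finite (phi H V ` proper_parts V)"
    using finite_proper_parts by simp
  ultimately show False
    using inj_on_finite[of "\<lambda>k. mda_hat (\<sigma> k)" UNIV] infinite_UNIV_nat by blast
qed

text \<open>From the first halting index on, the sequence is constant with the optimal
  value.\<close>

lemma mda_run_tendsto:
  assumes "mda_run H V \<sigma>"
  shows "(\<lambda>k. mda_alpha (\<sigma> k)) \<longlonglongrightarrow> R_ACO H V"
proof -
  obtain N where N: "mda_halted (\<sigma> N)" using mda_run_halts[OF assms] by blast
  have "mda_alpha (\<sigma> k) = R_ACO H V" if "k \<ge> N" for k
  proof -
    from that have "mda_halted (\<sigma> k)"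
      using N mda_run_stop[OF assms] by (induction k rule: dec_induct) auto
    then show ?thesis
      using mda_find_halted(1) mda_run_find[OF assms] by blast
  qed
  then have "\<forall>\<^sub>F k in sequentially. mda_alpha (\<sigma> k) = R_ACO H V"
    by (rule eventually_sequentiallyI)
  then show ?thesis by (rule tendsto_eventually)
qed

end

theorem theoremV1:
  fixes M :: "'w measure" and b :: real
    and V :: "'i set" and A :: "'i \<Rightarrow> 'a set" and Z :: "'i \<Rightarrow> 'w \<Rightarrow> 'a"
    and H :: "'i set \<Rightarrow> real"
  assumes "prob_space M" and "1 < b"
    and "finite V" and "card V > 1"
    and "\<And>i. i \<in> V \<Longrightarrow> countable (A i)"
    and "\<And>i. i \<in> V \<Longrightarrow> Z i \<in> M \<rightarrow>\<^sub>M count_space (A i)"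
    and "\<And>X. X \<subseteq> V \<Longrightarrow> finite_joint_entropy M b A Z X"
    and "H = joint_entropy M b A Z"
  shows
    "(\<comment> \<open>the algorithm can start and never gets stuck before halting\<close>
      (\<exists>s. mda_init H V s) \<and>
      (\<forall>s0 s. mda_init H V s0 \<and> (mda_step H V)\<^sup>*\<^sup>* s0 s \<and> \<not> mda_halted s
          \<longrightarrow> (\<exists>s'. mda_step H V s s'))) \<and>
     (\<forall>\<sigma>. mda_run H V \<sigma> \<longrightarrow>
        (\<exists>N. mda_halted (\<sigma> N)) \<and>
        (\<forall>N. mda_halted (\<sigma> N) \<longrightarrow>
           mda_alpha (\<sigma> N) = R_ACO H V \<and>
           fundamental_partition H V (mda_part (\<sigma> N)) \<and>
           mda_rate (\<sigma> N) \<in> opt_rates H V) \<and>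
        mono (\<lambda>k. mda_alpha (\<sigma> k)) \<and>
        (\<lambda>k. mda_alpha (\<sigma> k)) \<longlonglongrightarrow> R_ACO H V)"
proof -
  have "information_space M b"
    using assms(1,2) by (intro information_space.intro information_space_axioms.intro)
  \<comment> \<open>The random variables enter the analysis of the algorithm through the
    submodularity of their joint entropy.\<close>
  then interpret intersecting_submodular H V
    using assms(3-5,7) by unfold_locales (auto simp: assms(8) intro!: joint_entropy_submodular)
  show ?thesis
  proof (intro conjI allI impI)
    show "\<exists>s. mda_init H V s"
      unfolding mda_init_def by (rule mda_find_exists)
  next
    fix s0 s assume "mda_init H V s0 \<and> (mda_step H V)\<^sup>*\<^sup>* s0 s \<and> \<not> mda_halted s"
    then show "\<exists>s'. mda_step H V s s'"
      using mda_find_exists by (simp add: mda_step_def)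
  next
    fix \<sigma> assume run: "mda_run H V \<sigma>"
    show "\<exists>N. mda_halted (\<sigma> N)" by (rule mda_run_halts[OF run])
    show "mono (\<lambda>k. mda_alpha (\<sigma> k))" by (rule mda_run_mono[OF run])
    show "(\<lambda>k. mda_alpha (\<sigma> k)) \<longlonglongrightarrow> R_ACO H V" by (rule mda_run_tendsto[OF run])
    fix N assume "mda_halted (\<sigma> N)"
    then show "mda_alpha (\<sigma> N) = R_ACO H V" "fundamental_partition H V (mda_part (\<sigma> N))"
        "mda_rate (\<sigma> N) \<in> opt_rates H V"
      using mda_find_halted mda_run_find[OF run, of N] by blast+
  qed
qed

end
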